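(* Let $S$ be a consistent extension of $\mathsf{Succ}^{-}$ in the same language. Then for any $X\subseteq\mathbb{N}$, $X$ is weakly representable in $S$ if and only if $X$ is finite or co-finite.
   Context: $\mathsf{Succ}^{-}$ is the theory in the language $\{\mathbf{0},\mathbf{S}\}$ with axioms $\forall x\forall y(\mathbf{S}x=\mathbf{S}y\to x=y)$, $\forall x(\mathbf{S}x\ne\mathbf{0})$, $\forall x(x\ne\mathbf{0}\to\exists y(x=\mathbf{S}y))$. With $\overline{n}=\mathbf{S}^n\mathbf{0}$, a set $X\subseteq\mathbb{N}$ is weakly representable in $S$ if there is a formula $\phi(x)$ such that for all $n$, $n\in X\iff S\vdash\phi(\overline{n})$. *)

theory Defs
  imports Main
begin

text \<open>
  Classical first-order logic with equality over the language consisting of a constant \<open>\<zero>\<close>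
  and a unary function symbol \<open>S\<close>. Variables are de Bruijn indices: in \<open>All p\<close>, index \<open>0\<close>
  of \<open>p\<close> is the bound variable and index \<open>Suc n\<close> of \<open>p\<close> is the index \<open>n\<close> outside.
\<close>

datatype tm = Var nat | Zero | Succ tm

datatype fm = Fls | Eq tm tm | Imp fm fm | All fm

definition Neg :: "fm \<Rightarrow> fm" where
  "Neg p = Imp p Fls"

definition Exists :: "fm \<Rightarrow> fm" where
  "Exists p = Neg (All (Neg p))"

primrec fv_tm :: "tm \<Rightarrow> nat set" where
  "fv_tm (Var n) = {n}"
| "fv_tm Zero = {}"
| "fv_tm (Succ t) = fv_tm t"

primrec fv :: "fm \<Rightarrow> nat set" where
  "fv Fls = {}"
| "fv (Eq s t) = fv_tm s \<union> fv_tm t"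
| "fv (Imp p q) = fv p \<union> fv q"
| "fv (All p) = {n. Suc n \<in> fv p}"

definition sentence :: "fm \<Rightarrow> bool" where
  "sentence p \<longleftrightarrow> fv p = {}"

text \<open>Simultaneous capture-avoiding substitution.\<close>

primrec subst_tm :: "(nat \<Rightarrow> tm) \<Rightarrow> tm \<Rightarrow> tm" where
  "subst_tm \<sigma> (Var n) = \<sigma> n"
| "subst_tm \<sigma> Zero = Zero"
| "subst_tm \<sigma> (Succ t) = Succ (subst_tm \<sigma> t)"

definition shift_tm :: "tm \<Rightarrow> tm" where
  "shift_tm = subst_tm (\<lambda>n. Var (Suc n))"

definition under_binder :: "(nat \<Rightarrow> tm) \<Rightarrow> nat \<Rightarrow> tm" where
  "under_binder \<sigma> = case_nat (Var 0) (\<lambda>n. shift_tm (\<sigma> n))"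

primrec subst :: "(nat \<Rightarrow> tm) \<Rightarrow> fm \<Rightarrow> fm" where
  "subst \<sigma> Fls = Fls"
| "subst \<sigma> (Eq s t) = Eq (subst_tm \<sigma> s) (subst_tm \<sigma> t)"
| "subst \<sigma> (Imp p q) = Imp (subst \<sigma> p) (subst \<sigma> q)"
| "subst \<sigma> (All p) = All (subst (under_binder \<sigma>) p)"

definition shift :: "fm \<Rightarrow> fm" where
  "shift = subst (\<lambda>n. Var (Suc n))"

text \<open>\<open>inst p t\<close> replaces index \<open>0\<close> by \<open>t\<close> and lowers every other index by one.\<close>

definition inst :: "fm \<Rightarrow> tm \<Rightarrow> fm" where
  "inst p t = subst (case_nat t Var) p"

text \<open>
  Natural deduction. In \<open>AllI\<close> the eigenvariable is index \<open>0\<close>; shifting the hypotheses makes it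
  fresh for them.
\<close>

inductive proves :: "fm set \<Rightarrow> fm \<Rightarrow> bool" (infix \<open>\<turnstile>\<close> 50) where
  Hyp: "p \<in> \<Gamma> \<Longrightarrow> \<Gamma> \<turnstile> p"
| ImpI: "insert p \<Gamma> \<turnstile> q \<Longrightarrow> \<Gamma> \<turnstile> Imp p q"
| ImpE: "\<Gamma> \<turnstile> Imp p q \<Longrightarrow> \<Gamma> \<turnstile> p \<Longrightarrow> \<Gamma> \<turnstile> q"
| Contr: "insert (Neg p) \<Gamma> \<turnstile> Fls \<Longrightarrow> \<Gamma> \<turnstile> p"
| AllI: "shift ` \<Gamma> \<turnstile> p \<Longrightarrow> \<Gamma> \<turnstile> All p"
| AllE: "\<Gamma> \<turnstile> All p \<Longrightarrow> \<Gamma> \<turnstile> inst p t"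
| EqRefl: "\<Gamma> \<turnstile> Eq t t"
| EqSubst: "\<Gamma> \<turnstile> Eq s t \<Longrightarrow> \<Gamma> \<turnstile> inst p s \<Longrightarrow> \<Gamma> \<turnstile> inst p t"

text \<open>A theory is given by a set of axioms, not required to be deductively closed.\<close>

definition is_theory :: "fm set \<Rightarrow> bool" where
  "is_theory T \<longleftrightarrow> (\<forall>p\<in>T. sentence p)"

definition consistent :: "fm set \<Rightarrow> bool" where
  "consistent T \<longleftrightarrow> \<not> T \<turnstile> Fls"

definition extends :: "fm set \<Rightarrow> fm set \<Rightarrow> bool" where
  "extends T U \<longleftrightarrow> (\<forall>p. sentence p \<longrightarrow> U \<turnstile> p \<longrightarrow> T \<turnstile> p)"

definition Succ_minus :: "fm set" where
  "Succ_minus =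
    {All (All (Imp (Eq (Succ (Var 1)) (Succ (Var 0))) (Eq (Var 1) (Var 0)))),
     All (Neg (Eq (Succ (Var 0)) Zero)),
     All (Imp (Neg (Eq (Var 0) Zero)) (Exists (Eq (Var 1) (Succ (Var 0)))))}"

definition numeral_tm :: "nat \<Rightarrow> tm" where
  "numeral_tm n = (Succ ^^ n) Zero"

definition weakly_representable :: "fm set \<Rightarrow> nat set \<Rightarrow> bool" where
  "weakly_representable T X \<longleftrightarrow>
    (\<exists>p. fv p \<subseteq> {0} \<and> (\<forall>n. n \<in> X \<longleftrightarrow> T \<turnstile> inst p (numeral_tm n)))"

end

theory Submission
  imports Defs "HOL-Library.Countable"
begin

text \<open>
  If \<open>S\<close> does not prove \<open>p\<close>, then \<open>S \<union> {\<not> p}\<close> extends to a maximal consistent Henkin set;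
  since \<open>S\<close> consists of sentences, variables can serve as the witnesses. In the term model
  of such a set call an element standard if it equals a numeral. An Ehrenfeucht-Fraisse
  argument shows that \<open>p(n)\<close> and \<open>p(m)\<close> have the same truth value as soon as \<open>n\<close> and \<open>m\<close>
  exceed a bound depending on \<open>p\<close> only: a nonstandard move is answered by the same element,
  and a standard move by a standard element, as in the game on the natural numbers with
  successor. Hence \<open>S\<close> proves \<open>p(n)\<close> for almost all \<open>n\<close> or for only finitely many \<open>n\<close>.
\<close>

section \<open>Substitution\<close>

lemma subst_tm_cong: "(\<And>n. n \<in> fv_tm t \<Longrightarrow> \<sigma> n = \<tau> n) \<Longrightarrow> subst_tm \<sigma> t = subst_tm \<tau> t"
  by (induction t) auto

lemma subst_cong: "(\<And>n. n \<in> fv p \<Longrightarrow> \<sigma> n = \<tau> n) \<Longrightarrow> subst \<sigma> p = subst \<tau> p"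
proof (induction p arbitrary: \<sigma> \<tau>)
  case (Eq s t)
  then show ?case by (auto intro!: subst_tm_cong)
next
  case (Imp p q)
  have "subst \<sigma> p = subst \<tau> p" "subst \<sigma> q = subst \<tau> q"
    using Imp.prems by (auto intro: Imp.IH)
  then show ?case by simp
next
  case (All p)
  have "under_binder \<sigma> n = under_binder \<tau> n" if "n \<in> fv p" for n
    using that All.prems by (cases n) (auto simp: under_binder_def)
  then have "subst (under_binder \<sigma>) p = subst (under_binder \<tau>) p" by (rule All.IH)
  then show ?case by simp
qed simp

lemma subst_tm_Var: "subst_tm Var t = t"
  by (induction t) auto

lemma under_binder_Var: "under_binder Var = Var"
  by (rule ext) (auto simp: under_binder_def shift_tm_def split: nat.split)

lemma subst_Var: "subst Var p = p"
  by (induction p) (auto simp: subst_tm_Var under_binder_Var)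

lemma subst_tm_subst_tm: "subst_tm \<sigma> (subst_tm \<tau> t) = subst_tm (\<lambda>n. subst_tm \<sigma> (\<tau> n)) t"
  by (induction t) auto

lemma under_binder_comp:
  "(\<lambda>n. subst_tm (under_binder \<sigma>) (under_binder \<tau> n)) = under_binder (\<lambda>n. subst_tm \<sigma> (\<tau> n))"
  by (rule ext) (auto simp: under_binder_def shift_tm_def subst_tm_subst_tm split: nat.split)

text \<open>This fusion law reduces later substitution identities to pointwise equalities of maps
  from indices to terms.\<close>

lemma subst_subst: "subst \<sigma> (subst \<tau> p) = subst (\<lambda>n. subst_tm \<sigma> (\<tau> n)) p"
  by (induction p arbitrary: \<sigma> \<tau>) (auto simp: subst_tm_subst_tm under_binder_comp)

lemma subst_shift: "subst (under_binder \<sigma>) (shift p) = shift (subst \<sigma> p)"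
  by (auto simp: shift_def subst_subst under_binder_def shift_tm_def)

text \<open>Reading \<open>\<sigma>\<close> as an assignment, this is the quantifier clause:
  instantiating at \<open>t\<close> updates the assignment to
  \<open>case_nat t \<sigma>\<close>.\<close>

lemma inst_subst_under_binder: "inst (subst (under_binder \<sigma>) p) t = subst (case_nat t \<sigma>) p"
proof -
  have "(\<lambda>n. subst_tm (case_nat t Var) (under_binder \<sigma> n)) = case_nat t \<sigma>"
    by (rule ext)
      (auto simp: under_binder_def shift_tm_def subst_tm_subst_tm subst_tm_Var split: nat.split)
  then show ?thesis by (simp add: inst_def subst_subst)
qed

lemma subst_inst: "subst \<sigma> (inst p t) = inst (subst (under_binder \<sigma>) p) (subst_tm \<sigma> t)"
proof -
  have "(\<lambda>n. subst_tm \<sigma> (case_nat t Var n)) = case_nat (subst_tm \<sigma> t) \<sigma>"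
    by (rule ext) (auto split: nat.split)
  then show ?thesis by (simp add: inst_subst_under_binder) (simp add: inst_def subst_subst)
qed

lemma finite_fv_tm: "finite (fv_tm t)"
  by (induction t) auto

lemma finite_fv: "finite (fv p)"
proof (induction p)
  case (All p)
  have "fv (All p) = Suc -` fv p" by auto
  with All show ?case by (simp add: finite_vimageI)
qed (auto simp: finite_fv_tm)

section \<open>Derivations\<close>

text \<open>Allowing any \<open>\<Delta>\<close> above the substituted hypotheses builds weakening
  in: \<open>proves_mono\<close> is the case of the identity substitution.\<close>

lemma proves_subst: "\<Gamma> \<turnstile> p \<Longrightarrow> subst \<sigma> ` \<Gamma> \<subseteq> \<Delta> \<Longrightarrow> \<Delta> \<turnstile> subst \<sigma> p"
proof (induction arbitrary: \<sigma> \<Delta> rule: proves.induct)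
  case (Hyp p \<Gamma>)
  then show ?case by (auto intro: proves.Hyp)
next
  case (ImpI p \<Gamma> q)
  have "insert (subst \<sigma> p) \<Delta> \<turnstile> subst \<sigma> q" using ImpI.prems by (intro ImpI.IH) auto
  then show ?case by (simp add: proves.ImpI)
next
  case (ImpE \<Gamma> p q)
  then show ?case by (metis proves.ImpE subst.simps(3))
next
  case (Contr p \<Gamma>)
  have "insert (Neg (subst \<sigma> p)) \<Delta> \<turnstile> subst \<sigma> Fls"
    using Contr.prems by (intro Contr.IH) (auto simp: Neg_def)
  then show ?case by (simp add: proves.Contr)
next
  case (AllI \<Gamma> p)
  have "shift ` \<Delta> \<turnstile> subst (under_binder \<sigma>) p"
    using AllI.prems by (intro AllI.IH) (auto simp: subst_shift)
  then show ?case by (simp add: proves.AllI)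
next
  case (AllE \<Gamma> p t)
  then show ?case by (metis proves.AllE subst.simps(4) subst_inst)
next
  case (EqRefl \<Gamma> t)
  then show ?case by (simp add: proves.EqRefl)
next
  case (EqSubst \<Gamma> s t p)
  have "\<Delta> \<turnstile> Eq (subst_tm \<sigma> s) (subst_tm \<sigma> t)" "\<Delta> \<turnstile> inst (subst (under_binder \<sigma>) p) (subst_tm \<sigma> s)"
    using EqSubst.IH[OF EqSubst.prems] by (simp_all add: subst_inst)
  then show ?case unfolding subst_inst by (rule proves.EqSubst)
qed

lemma proves_mono: "\<Gamma> \<turnstile> p \<Longrightarrow> \<Gamma> \<subseteq> \<Delta> \<Longrightarrow> \<Delta> \<turnstile> p"
  using proves_subst[of \<Gamma> p Var \<Delta>] by (simp add: subst_Var)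

lemma proves_finite: "\<Gamma> \<turnstile> p \<Longrightarrow> \<exists>\<Delta>\<subseteq>\<Gamma>. finite \<Delta> \<and> \<Delta> \<turnstile> p"
proof (induction rule: proves.induct)
  case (Hyp p \<Gamma>)
  then show ?case by (intro exI[of _ "{p}"]) (auto intro: proves.Hyp)
next
  case (ImpI p \<Gamma> q)
  then obtain \<Delta> where "\<Delta> \<subseteq> insert p \<Gamma>" "finite \<Delta>" "\<Delta> \<turnstile> q" by blast
  then show ?case
    by (intro exI[of _ "\<Delta> - {p}"]) (auto intro!: proves.ImpI elim: proves_mono)
next
  case (ImpE \<Gamma> p q)
  then obtain \<Delta> \<Delta>' where "\<Delta> \<subseteq> \<Gamma>" "finite \<Delta>" "\<Delta> \<turnstile> Imp p q" "\<Delta>' \<subseteq> \<Gamma>" "finite \<Delta>'" "\<Delta>' \<turnstile> p"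
    by blast
  moreover from this have "\<Delta> \<union> \<Delta>' \<turnstile> q"
    by (meson proves.ImpE proves_mono sup_ge1 sup_ge2)
  ultimately show ?case by (intro exI[of _ "\<Delta> \<union> \<Delta>'"]) auto
next
  case (Contr p \<Gamma>)
  then obtain \<Delta> where "\<Delta> \<subseteq> insert (Neg p) \<Gamma>" "finite \<Delta>" "\<Delta> \<turnstile> Fls" by blast
  then show ?case
    by (intro exI[of _ "\<Delta> - {Neg p}"]) (auto intro!: proves.Contr[of p] elim: proves_mono)
next
  case (AllI \<Gamma> p)
  then obtain \<Delta> where "\<Delta> \<subseteq> shift ` \<Gamma>" "finite \<Delta>" "\<Delta> \<turnstile> p" by blast
  then show ?case by (metis finite_subset_image proves.AllI)
next
  case (AllE \<Gamma> p t)
  then show ?case by (meson proves.AllE)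
next
  case (EqRefl \<Gamma> t)
  then show ?case by (intro exI[of _ "{}"]) (auto intro: proves.EqRefl)
next
  case (EqSubst \<Gamma> s t p)
  then obtain \<Delta> \<Delta>' where "\<Delta> \<subseteq> \<Gamma>" "finite \<Delta>" "\<Delta> \<turnstile> Eq s t"
      "\<Delta>' \<subseteq> \<Gamma>" "finite \<Delta>'" "\<Delta>' \<turnstile> inst p s"
    by blast
  moreover from this have "\<Delta> \<union> \<Delta>' \<turnstile> inst p t"
    by (meson proves.EqSubst proves_mono sup_ge1 sup_ge2)
  ultimately show ?case by (intro exI[of _ "\<Delta> \<union> \<Delta>'"]) auto
qed

lemma inconsistent_insert: "\<not> consistent (insert p \<Gamma>) \<Longrightarrow> \<Gamma> \<turnstile> Neg p"
  by (auto simp: consistent_def Neg_def intro: proves.ImpI)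

lemma inconsistent_insert_Neg: "\<not> consistent (insert (Neg p) \<Gamma>) \<Longrightarrow> \<Gamma> \<turnstile> p"
  by (auto simp: consistent_def intro: proves.Contr)

lemma consistent_not_both: "consistent \<Gamma> \<Longrightarrow> \<Gamma> \<turnstile> p \<Longrightarrow> \<not> \<Gamma> \<turnstile> Neg p"
  by (auto simp: consistent_def Neg_def dest: proves.ImpE)

text \<open>\<open>AllI\<close> with a named eigenvariable \<open>k\<close>. Renaming
  \<open>k\<close> to index 0 and shifting all else turns the hypotheses into their shifts, as none
  mentions \<open>k\<close>, and the instance back into \<open>p\<close>.\<close>

lemma generalize_fresh:
  assumes "\<Gamma> \<turnstile> inst p (Var k)" and fresh: "k \<notin> \<Union> (fv ` \<Gamma>)" "k \<notin> fv (All p)"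
  shows "\<Gamma> \<turnstile> All p"
proof -
  define \<sigma> where "\<sigma> n = (if n = k then Var 0 else Var (Suc n))" for n
  have "subst \<sigma> q = shift q" if "q \<in> \<Gamma>" for q
    unfolding shift_def using that fresh(1) by (intro subst_cong) (auto simp: \<sigma>_def)
  then have "shift ` \<Gamma> \<turnstile> subst \<sigma> (inst p (Var k))"
    by (intro proves_subst[OF assms(1)]) auto
  moreover have "subst \<sigma> (inst p (Var k)) = subst Var p"
    unfolding inst_def subst_subst using fresh(2)
    by (intro subst_cong) (auto simp: \<sigma>_def split: nat.split)
  ultimately show ?thesis by (simp add: subst_Var proves.AllI)
qed

section \<open>Henkin sets\<close>

instance tm :: countable by countable_datatype

instance fm :: countable by countable_datatype

text \<open>Such a set doubles as a term model: its elements are all terms, open ones included, and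
  membership is truth. Deductive closure is derived in \<open>closed\<close>.\<close>

locale henkin =
  fixes \<Gamma> :: "fm set"
  assumes consistent: "consistent \<Gamma>"
    and complete: "p \<in> \<Gamma> \<or> \<Gamma> \<turnstile> Neg p"
    and witness: "(\<And>t. inst p t \<in> \<Gamma>) \<Longrightarrow> All p \<in> \<Gamma>"

section \<open>Extension of consistent sets to Henkin sets\<close>

definition fresh_var :: "fm set \<Rightarrow> nat" where
  "fresh_var G = (SOME k. k \<notin> \<Union> (fv ` G))"

text \<open>A rejected formula is already refuted by \<open>G\<close>. If it is universal, a
  counterexample at a fresh variable is added as well.\<close>

definition henkin_step :: "fm set \<Rightarrow> fm \<Rightarrow> fm set" where
  "henkin_step G p =
    (if consistent (insert p G) then insert p G
     else case p of
       All q \<Rightarrow> insert (Neg (inst q (Var (fresh_var (insert p G))))) G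
     | _ \<Rightarrow> G)"

text \<open>Every formula \<open>p\<close> is treated, namely at stage
  \<open>to_nat p\<close>.\<close>

primrec henkin_chain :: "fm set \<Rightarrow> nat \<Rightarrow> fm set" where
  "henkin_chain G 0 = G"
| "henkin_chain G (Suc n) = henkin_step (henkin_chain G n) (from_nat n)"

lemma fresh_var:
  assumes "finite (\<Union> (fv ` G))"
  shows "fresh_var G \<notin> \<Union> (fv ` G)"
  unfolding fresh_var_def using ex_new_if_finite[OF infinite_UNIV_nat assms] by (rule someI_ex)

lemma finite_fv_henkin_step: "finite (\<Union> (fv ` G)) \<Longrightarrow> finite (\<Union> (fv ` henkin_step G p))"
  unfolding henkin_step_def by (auto simp: finite_fv split: fm.split)

text \<open>If the added counterexample were inconsistent, \<open>G\<close> would prove the instance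
  at the fresh variable, hence \<open>All q\<close>, whose negation it proves because
  \<open>All q\<close> was rejected.\<close>

lemma consistent_henkin_step:
  assumes "finite (\<Union> (fv ` G))" "consistent G"
  shows "consistent (henkin_step G p)"
proof (cases "\<not> consistent (insert p G) \<and> (\<exists>q. p = All q)")
  case False
  then show ?thesis using assms(2) by (auto simp: henkin_step_def split: fm.split)
next
  case True
  then obtain q where q: "p = All q" and incons: "\<not> consistent (insert (All q) G)" by blast
  define k where "k = fresh_var (insert (All q) G)"
  have k: "k \<notin> \<Union> (fv ` G)" "k \<notin> fv (All q)"
    using fresh_var[of "insert (All q) G"] assms(1) finite_fv[of "All q"] by (auto simp: k_def)
  have "consistent (insert (Neg (inst q (Var k))) G)"
    using generalize_fresh[OF _ k] inconsistent_insert_Neg consistent_not_both[OF assms(2)]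
      inconsistent_insert[OF incons] by blast
  then show ?thesis using incons by (simp add: henkin_step_def q k_def)
qed

lemma henkin_chain_invariant:
  assumes "finite (\<Union> (fv ` G))" "consistent G"
  shows "finite (\<Union> (fv ` henkin_chain G n)) \<and> consistent (henkin_chain G n)"
  using assms by (induction n) (simp_all add: finite_fv_henkin_step consistent_henkin_step)

lemma henkin_chain_mono: "mono (henkin_chain G)"
  by (intro mono_iff_le_Suc[THEN iffD2]) (auto simp: henkin_step_def split: fm.split)

text \<open>A derivation of \<open>Fls\<close> uses finitely many hypotheses, and these all lie in
  one stage of the increasing chain.\<close>

lemma consistent_henkin_union:
  assumes "finite (\<Union> (fv ` G))" "consistent G"
  shows "consistent (\<Union> (range (henkin_chain G)))"
  unfolding consistent_def
proof
  assume "\<Union> (range (henkin_chain G)) \<turnstile> Fls"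
  then obtain \<Delta> where \<Delta>: "\<Delta> \<subseteq> \<Union> (range (henkin_chain G))" "finite \<Delta>" "\<Delta> \<turnstile> Fls"
    using proves_finite by blast
  have "\<exists>n. \<Delta> \<subseteq> henkin_chain G n"
    using \<Delta>(2,1)
  proof (induction rule: finite_induct)
    case (insert p \<Delta>)
    then obtain n m where nm: "\<Delta> \<subseteq> henkin_chain G n" "p \<in> henkin_chain G m" by auto
    have "henkin_chain G n \<subseteq> henkin_chain G (max n m)" "henkin_chain G m \<subseteq> henkin_chain G (max n m)"
      by (simp_all add: monoD[OF henkin_chain_mono])
    with nm show ?case by blast
  qed simp
  then show False
    using \<Delta>(3) henkin_chain_invariant[OF assms] proves_mono unfolding consistent_def by blast
qed

lemma henkin_extension:
  assumes "finite (\<Union> (fv ` G))" "consistent G"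
  shows "\<exists>\<Gamma>. henkin \<Gamma> \<and> G \<subseteq> \<Gamma>"
proof -
  define \<Gamma> where "\<Gamma> = \<Union> (range (henkin_chain G))"
  have cons: "consistent \<Gamma>" unfolding \<Gamma>_def using assms by (rule consistent_henkin_union)
  have chain: "henkin_chain G n \<subseteq> \<Gamma>" for n by (auto simp: \<Gamma>_def)
  have step: "henkin_step (henkin_chain G (to_nat p)) p \<subseteq> \<Gamma>" for p :: fm
    using chain[of "Suc (to_nat p)"] by simp
  have complete: "p \<in> \<Gamma> \<or> \<Gamma> \<turnstile> Neg p" for p
  proof (cases "consistent (insert p (henkin_chain G (to_nat p)))")
    case True
    then show ?thesis using step[of p] by (auto simp: henkin_step_def)
  next
    case False
    then show ?thesis using inconsistent_insert proves_mono[OF _ chain] by blast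
  qed
  have "All p \<in> \<Gamma>" if all: "\<And>t. inst p t \<in> \<Gamma>" for p
  proof (cases "consistent (insert (All p) (henkin_chain G (to_nat (All p))))")
    case True
    then show ?thesis using step[of "All p"] by (auto simp: henkin_step_def)
  next
    case False
    \<comment> \<open>The rejected \<open>All p\<close> left a counterexample in
      \<open>\<Gamma>\<close>, which contradicts the assumption on all instances.\<close>
    then obtain k where "Neg (inst p (Var k)) \<in> \<Gamma>"
      using step[of "All p"] by (auto simp: henkin_step_def)
    then show ?thesis using all[of "Var k"] consistent_not_both[OF cons] proves.Hyp by blast
  qed
  then have "henkin \<Gamma>" using cons complete by (simp add: henkin_def)
  then show ?thesis using chain[of 0] by auto
qed

text \<open>As \<open>T\<close> consists of sentences, only the finitely many free variables of
  \<open>p\<close> occur in the starting set, so fresh variables are available at every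
  stage.\<close>

lemma completeness:
  assumes "is_theory T" "\<not> T \<turnstile> p"
  shows "\<exists>\<Gamma>. henkin \<Gamma> \<and> T \<subseteq> \<Gamma> \<and> p \<notin> \<Gamma>"
proof -
  have "consistent (insert (Neg p) T)" using assms(2) inconsistent_insert_Neg by blast
  moreover have "\<Union> (fv ` insert (Neg p) T) = fv (Neg p)"
    using assms(1) by (auto simp: is_theory_def sentence_def)
  ultimately obtain \<Gamma> where \<Gamma>: "henkin \<Gamma>" "insert (Neg p) T \<subseteq> \<Gamma>"
    using henkin_extension[of "insert (Neg p) T"] finite_fv by metis
  then have "p \<notin> \<Gamma>"
    using consistent_not_both[OF henkin.consistent[OF \<Gamma>(1)]] proves.Hyp by blast
  with \<Gamma> show ?thesis by blast
qed

section \<open>Truth and equality in a Henkin set\<close>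

context henkin
begin

lemma closed: "\<Gamma> \<turnstile> p \<Longrightarrow> p \<in> \<Gamma>"
  using complete consistent_not_both[OF consistent] by blast

lemma in_iff: "p \<in> \<Gamma> \<longleftrightarrow> \<Gamma> \<turnstile> p"
  using closed proves.Hyp by blast

lemma Fls_notin: "Fls \<notin> \<Gamma>"
  using consistent by (simp add: consistent_def in_iff)

lemma Imp_iff: "Imp p q \<in> \<Gamma> \<longleftrightarrow> (p \<in> \<Gamma> \<longrightarrow> q \<in> \<Gamma>)"
proof
  assume "p \<in> \<Gamma> \<longrightarrow> q \<in> \<Gamma>"
  then consider "q \<in> \<Gamma>" | "\<Gamma> \<turnstile> Neg p" using complete by blast
  then show "Imp p q \<in> \<Gamma>"
  proof cases
    case 1
    then show ?thesis by (meson closed proves.Hyp proves.ImpI insertI2)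
  next
    case 2
    then have "insert p \<Gamma> \<turnstile> Imp p Fls" unfolding Neg_def by (rule proves_mono) auto
    then have "insert p \<Gamma> \<turnstile> Fls" by (rule proves.ImpE) (simp add: proves.Hyp)
    then have "insert p \<Gamma> \<turnstile> q" by (meson proves.Contr proves_mono subset_insertI)
    then show ?thesis by (meson closed proves.ImpI)
  qed
qed (auto simp: in_iff intro: proves.ImpE)

text \<open>Quantifiers range over all terms: one direction is \<open>AllE\<close>, the other is
  \<open>witness\<close>.\<close>

lemma All_iff: "subst \<sigma> (All p) \<in> \<Gamma> \<longleftrightarrow> (\<forall>t. subst (case_nat t \<sigma>) p \<in> \<Gamma>)"
proof
  assume "subst \<sigma> (All p) \<in> \<Gamma>"
  then have "\<Gamma> \<turnstile> All (subst (under_binder \<sigma>) p)" by (simp add: in_iff)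
  from proves.AllE[OF this] show "\<forall>t. subst (case_nat t \<sigma>) p \<in> \<Gamma>"
    by (simp add: inst_subst_under_binder in_iff)
next
  assume "\<forall>t. subst (case_nat t \<sigma>) p \<in> \<Gamma>"
  then show "subst \<sigma> (All p) \<in> \<Gamma>" by (simp add: witness inst_subst_under_binder)
qed

abbreviation equal :: "tm \<Rightarrow> tm \<Rightarrow> bool" (infix \<open>\<approx>\<close> 50) where
  "s \<approx> t \<equiv> Eq s t \<in> \<Gamma>"

lemma equal_refl: "t \<approx> t"
  by (simp add: closed proves.EqRefl)

lemma equal_subst: "s \<approx> t \<Longrightarrow> inst p s \<in> \<Gamma> \<Longrightarrow> inst p t \<in> \<Gamma>"
  unfolding in_iff by (rule proves.EqSubst)

text \<open>Shifting keeps a fixed term clear of index 0, the hole that \<open>inst\<close> fills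
  when equals are replaced.\<close>

lemma shifted_tm: "subst_tm (case_nat u Var) (shift_tm t) = t"
  by (simp add: shift_tm_def subst_tm_subst_tm subst_tm_Var)

lemma equal_sym: "s \<approx> t \<Longrightarrow> t \<approx> s"
  using equal_subst[of s t "Eq (Var 0) (shift_tm s)"] equal_refl
  by (simp add: inst_def shifted_tm)

lemma equal_trans: "s \<approx> t \<Longrightarrow> t \<approx> u \<Longrightarrow> s \<approx> u"
  using equal_subst[of t u "Eq (shift_tm s) (Var 0)"] by (simp add: inst_def shifted_tm)

lemma equal_Succ: "s \<approx> t \<Longrightarrow> Succ s \<approx> Succ t"
  using equal_subst[of s t "Eq (Succ (shift_tm s)) (Succ (Var 0))"] equal_refl
  by (simp add: inst_def shifted_tm)

lemma equal_cong: "s \<approx> s' \<Longrightarrow> t \<approx> t' \<Longrightarrow> s \<approx> t \<longleftrightarrow> s' \<approx> t'"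
  by (meson equal_sym equal_trans)

end

section \<open>Models of the successor axioms\<close>

locale succ_model = henkin +
  assumes Succ_equal_D: "Eq (Succ s) (Succ t) \<in> \<Gamma> \<Longrightarrow> Eq s t \<in> \<Gamma>"
    and Succ_neq_Zero: "Eq (Succ t) Zero \<notin> \<Gamma>"

lemma numeral_tm_simps [simp]: "numeral_tm 0 = Zero" "numeral_tm (Suc n) = Succ (numeral_tm n)"
  by (simp_all add: numeral_tm_def)

lemma subst_numeral_tm [simp]: "subst_tm \<sigma> (numeral_tm n) = numeral_tm n"
  by (induction n) auto

context succ_model
begin

lemma Succ_equal_iff: "Succ s \<approx> Succ t \<longleftrightarrow> s \<approx> t"
  using Succ_equal_D equal_Succ by blast

text \<open>The standard elements thus form a copy of the natural numbers, and equality among them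
  becomes arithmetic on indices.\<close>

lemma numeral_equal_iff: "numeral_tm n \<approx> numeral_tm m \<longleftrightarrow> n = m"
proof (induction n arbitrary: m)
  case 0
  show ?case using Succ_neq_Zero equal_sym equal_refl by (cases m) auto
next
  case (Suc n)
  then show ?case using Succ_neq_Zero by (cases m) (auto simp: Succ_equal_iff)
qed

definition standard :: "tm \<Rightarrow> bool" where
  "standard t \<longleftrightarrow> (\<exists>n. t \<approx> numeral_tm n)"

lemma standard_cong: "s \<approx> t \<Longrightarrow> standard s \<longleftrightarrow> standard t"
  unfolding standard_def by (meson equal_sym equal_trans)

lemma standard_Succ_iff: "standard (Succ t) \<longleftrightarrow> standard t"
proof
  assume "standard (Succ t)"
  then obtain n where n: "Succ t \<approx> numeral_tm n" by (auto simp: standard_def)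
  with Succ_neq_Zero obtain m where "n = Suc m" by (cases n) auto
  with n show "standard t" by (auto simp: standard_def Succ_equal_iff)
next
  assume "standard t"
  then show "standard (Succ t)" unfolding standard_def by (metis equal_Succ numeral_tm_simps(2))
qed

end

section \<open>The back-and-forth argument\<close>

primrec depth_tm :: "tm \<Rightarrow> nat" where
  "depth_tm (Var n) = 0"
| "depth_tm Zero = 0"
| "depth_tm (Succ t) = Suc (depth_tm t)"

text \<open>The distance up to which a formula can compare elements. An equation sees offsets up to
  its depth; a quantifier doubles the distance, since a new point may lie within \<open>d\<close> of
  two points that are \<open>2 * d\<close> apart.\<close>

primrec radius :: "fm \<Rightarrow> nat" where
  "radius Fls = 0"
| "radius (Eq s t) = max (depth_tm s) (depth_tm t)"
| "radius (Imp p q) = max (radius p) (radius q)"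
| "radius (All p) = 2 * radius p"

text \<open>\<open>R\<close> is a position of the game: the pairs of standard elements chosen so far. The pair \<open>(0, 0)\<close>
  accounts for the constant \<open>Zero\<close>.\<close>

definition position :: "nat \<Rightarrow> (nat \<times> nat) set \<Rightarrow> bool" where
  "position d R \<longleftrightarrow> finite R \<and> (0, 0) \<in> R \<and>
    (\<forall>a b a' b'. (a, b) \<in> R \<longrightarrow> (a', b') \<in> R \<longrightarrow>
      \<bar>int a - int a'\<bar> \<le> int d \<or> \<bar>int b - int b'\<bar> \<le> int d \<longrightarrow> int a - int a' = int b - int b')"

lemma positionI:
  assumes "finite R" "(0, 0) \<in> R"
    and "\<And>a b a' b'. (a, b) \<in> R \<Longrightarrow> (a', b') \<in> R \<Longrightarrow>
      \<bar>int a - int a'\<bar> \<le> int d \<or> \<bar>int b - int b'\<bar> \<le> int d \<Longrightarrow> int a - int a' = int b - int b'"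
  shows "position d R"
  unfolding position_def
proof (intro conjI allI impI)
  fix a b a' b'
  assume "(a, b) \<in> R" "(a', b') \<in> R"
    "\<bar>int a - int a'\<bar> \<le> int d \<or> \<bar>int b - int b'\<bar> \<le> int d"
  then show "int a - int a' = int b - int b'" by (rule assms(3))
qed (fact assms)+

lemma position_close:
  assumes "position d R" "(a, b) \<in> R" "(a', b') \<in> R"
    and "\<bar>int a - int a'\<bar> \<le> int d \<or> \<bar>int b - int b'\<bar> \<le> int d"
  shows "int a - int a' = int b - int b'"
  using assms(1)[unfolded position_def, THEN conjunct2, THEN conjunct2, rule_format, OF assms(2-)] .

lemma position_finite: "position d R \<Longrightarrow> finite R"
  by (simp add: position_def)

lemma position_zero: "position d R \<Longrightarrow> (0, 0) \<in> R"
  by (simp add: position_def)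

lemma position_mono:
  assumes "position d R" "d' \<le> d"
  shows "position d' R"
proof (rule positionI)
  fix a b a' b'
  assume "(a, b) \<in> R" "(a', b') \<in> R"
    and close: "\<bar>int a - int a'\<bar> \<le> int d' \<or> \<bar>int b - int b'\<bar> \<le> int d'"
  moreover have "int d' \<le> int d" using assms(2) by simp
  with close have "\<bar>int a - int a'\<bar> \<le> int d \<or> \<bar>int b - int b'\<bar> \<le> int d" by (meson order_trans)
  ultimately show "int a - int a' = int b - int b'" using position_close[OF assms(1)] by blast
qed (use position_finite[OF assms(1)] position_zero[OF assms(1)] in simp_all)

text \<open>The game is symmetric, so only the forth direction has to be played.\<close>

lemma position_converse:
  assumes "position d R"
  shows "position d (R\<inverse>)"
proof (rule positionI)
  fix a b a' b'
  assume "(a, b) \<in> R\<inverse>" "(a', b') \<in> R\<inverse>"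
    and "\<bar>int a - int a'\<bar> \<le> int d \<or> \<bar>int b - int b'\<bar> \<le> int d"
  then have "int b - int b' = int a - int a'"
    by (intro position_close[OF assms]) auto
  then show "int a - int a' = int b - int b'" by (rule sym)
qed (use position_finite[OF assms] position_zero[OF assms] in simp_all)

lemma position_insert:
  assumes "position d R"
    and "\<And>a b. (a, b) \<in> R \<Longrightarrow>
      \<bar>int c - int a\<bar> \<le> int d \<or> \<bar>int c' - int b\<bar> \<le> int d \<Longrightarrow> int c - int a = int c' - int b"
  shows "position d (insert (c, c') R)"
proof -
  have sym: "int a - int c = int b - int c'"
    if "(a, b) \<in> R" "\<bar>int a - int c\<bar> \<le> int d \<or> \<bar>int b - int c'\<bar> \<le> int d" for a b
  proof -
    have "int c - int a = int c' - int b"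
      using that(2) by (intro assms(2)[OF that(1)]) (simp add: abs_minus_commute)
    then show ?thesis by simp
  qed
  show ?thesis
  proof (rule positionI)
    fix a b a' b'
    assume ab: "(a, b) \<in> insert (c, c') R" "(a', b') \<in> insert (c, c') R"
      and close: "\<bar>int a - int a'\<bar> \<le> int d \<or> \<bar>int b - int b'\<bar> \<le> int d"
    consider "(a, b) \<in> R" "(a', b') \<in> R" | "(a, b) \<in> R" "a' = c" "b' = c'"
      | "a = c" "b = c'" "(a', b') \<in> R" | "a = c" "b = c'" "a' = c" "b' = c'"
      using ab by auto
    then show "int a - int a' = int b - int b'"
    proof cases
      case 1
      then show ?thesis using close by (rule position_close[OF assms(1)])
    next
      case 2
      then show ?thesis using close sym[of a b] by blast
    next
      case 3
      then show ?thesis using close assms(2)[of a' b'] by blast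
    qed simp
  qed (use position_finite[OF assms(1)] position_zero[OF assms(1)] in simp_all)
qed

text \<open>If \<open>c\<close> is within \<open>d\<close> of an old point, its offset is copied to
  the partner of that point; otherwise the answer is placed far from all partners.\<close>

lemma position_forth:
  assumes R: "position (2 * d) R"
  shows "\<exists>c'. position d (insert (c, c') R)"
proof (cases "\<exists>(a, b)\<in>R. \<bar>int c - int a\<bar> \<le> int d")
  case True
  then obtain a b where ab: "(a, b) \<in> R" "\<bar>int c - int a\<bar> \<le> int d" by auto
  \<comment> \<open>The copied point must not fall below zero. A partner \<open>b\<close> up to
    \<open>2 * d\<close> equals \<open>a\<close> by comparison with \<open>(0, 0)\<close>; a larger
    one leaves room for an offset of at most \<open>d\<close>.\<close>
  have "int b + (int c - int a) \<ge> 0"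
  proof (cases "int b \<le> 2 * int d")
    case True
    then have "a = b" using position_close[OF R ab(1) position_zero[OF R]] by simp
    then show ?thesis by simp
  next
    case False
    then show ?thesis using ab(2) by linarith
  qed
  then obtain c' where c': "int c' = int b + (int c - int a)" by (metis nonneg_int_cases)
  have "position d (insert (c, c') R)"
  proof (rule position_insert)
    show "position d R" using R by (rule position_mono) simp
  next
    fix a' b' assume a'b': "(a', b') \<in> R"
      and close: "\<bar>int c - int a'\<bar> \<le> int d \<or> \<bar>int c' - int b'\<bar> \<le> int d"
    \<comment> \<open>The triangle inequality through the new point spends the factor 2.\<close>
    have "\<bar>int a - int a'\<bar> \<le> 2 * int d \<or> \<bar>int b - int b'\<bar> \<le> 2 * int d"
      using close
    proof
      assume "\<bar>int c - int a'\<bar> \<le> int d"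
      then have "\<bar>int a - int a'\<bar> \<le> 2 * int d" using ab(2) by linarith
      then show ?thesis ..
    next
      assume "\<bar>int c' - int b'\<bar> \<le> int d"
      then have "\<bar>int b - int b'\<bar> \<le> 2 * int d" using ab(2) c' by linarith
      then show ?thesis ..
    qed
    then have "int a - int a' = int b - int b'" using position_close[OF R ab(1) a'b'] by simp
    then show "int c - int a' = int c' - int b'" using c' by linarith
  qed
  then show ?thesis ..
next
  case False
  have "finite (snd ` R)" using position_finite[OF R] by simp
  then obtain B where B: "\<And>b. b \<in> snd ` R \<Longrightarrow> b \<le> B" using finite_nat_set_iff_bounded_le by auto
  \<comment> \<open>\<open>B + d + 1\<close> is more than \<open>d\<close> away from every second
    component, so no closeness condition applies to the new pair.\<close>
  have "position d (insert (c, B + d + 1) R)"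
  proof (rule position_insert)
    show "position d R" using R by (rule position_mono) simp
  next
    fix a b assume "(a, b) \<in> R"
      and close: "\<bar>int c - int a\<bar> \<le> int d \<or> \<bar>int (B + d + 1) - int b\<bar> \<le> int d"
    then have "b \<le> B" "\<not> \<bar>int c - int a\<bar> \<le> int d" using B False by force+
    with close show "int c - int a = int (B + d + 1) - int b" by auto
  qed
  then show ?thesis ..
qed

section \<open>Transfer of truth between related assignments\<close>

context succ_model
begin

text \<open>A nonstandard element is matched with the identical term; standard elements are matched
  through \<open>R\<close>, up to provable equality with numerals.\<close>

definition related :: "(nat \<times> nat) set \<Rightarrow> tm \<Rightarrow> tm \<Rightarrow> bool" where
  "related R s t \<longleftrightarrow> (s = t \<and> \<not> standard s) \<or>
    (\<exists>(a, b)\<in>R. s \<approx> numeral_tm a \<and> t \<approx> numeral_tm b)"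

lemma related_mono: "related R s t \<Longrightarrow> R \<subseteq> R' \<Longrightarrow> related R' s t"
  unfolding related_def by blast

lemma related_converse: "related R s t \<Longrightarrow> related (R\<inverse>) t s"
  unfolding related_def by fast

text \<open>Each \<open>Succ\<close> raises the common offset \<open>e\<close> by one on both sides
  and keeps nonstandard terms nonstandard; \<open>Zero\<close> comes from the pair
  \<open>(0, 0)\<close>.\<close>

lemma related_subst_tm:
  assumes "\<And>i. related R (\<sigma> i) (\<tau> i)" "(0, 0) \<in> R"
  shows "(subst_tm \<sigma> t = subst_tm \<tau> t \<and> \<not> standard (subst_tm \<sigma> t)) \<or>
    (\<exists>a b e. (a, b) \<in> R \<and> e \<le> depth_tm t \<and>
      subst_tm \<sigma> t \<approx> numeral_tm (e + a) \<and> subst_tm \<tau> t \<approx> numeral_tm (e + b))"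
proof (induction t)
  case (Var i)
  then show ?case using assms(1)[of i] by (auto simp: related_def)
next
  case Zero
  have "Zero \<approx> numeral_tm (0 + 0)" by (simp add: equal_refl)
  then show ?case using assms(2) by fastforce
next
  case (Succ t)
  from Succ.IH show ?case
  proof (elim disjE exE conjE)
    fix a b e
    assume "(a, b) \<in> R" "e \<le> depth_tm t"
      "subst_tm \<sigma> t \<approx> numeral_tm (e + a)" "subst_tm \<tau> t \<approx> numeral_tm (e + b)"
    then have "(a, b) \<in> R \<and> Suc e \<le> depth_tm (Succ t) \<and>
      subst_tm \<sigma> (Succ t) \<approx> numeral_tm (Suc e + a) \<and> subst_tm \<tau> (Succ t) \<approx> numeral_tm (Suc e + b)"
      by (simp add: equal_Succ)
    then show ?thesis by blast
  qed (simp add: standard_Succ_iff)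
qed

lemma equal_transfer:
  assumes R: "position (max (depth_tm s) (depth_tm t)) R" and rel: "\<And>i. related R (\<sigma> i) (\<tau> i)"
  shows "subst_tm \<sigma> s \<approx> subst_tm \<sigma> t \<longleftrightarrow> subst_tm \<tau> s \<approx> subst_tm \<tau> t"
proof -
  have zero: "(0, 0) \<in> R" using R by (rule position_zero)
  note s = related_subst_tm[of R \<sigma> \<tau> s, OF rel zero]
    and t = related_subst_tm[of R \<sigma> \<tau> t, OF rel zero]
  show ?thesis
  proof (cases "standard (subst_tm \<sigma> s) \<and> standard (subst_tm \<sigma> t)")
    case False
    have std: "standard (subst_tm \<sigma> s) \<longleftrightarrow> standard (subst_tm \<tau> s)"
      "standard (subst_tm \<sigma> t) \<longleftrightarrow> standard (subst_tm \<tau> t)"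
      using s t by (auto simp: standard_def)
    have same: "\<not> standard (subst_tm \<sigma> s) \<Longrightarrow> subst_tm \<sigma> s = subst_tm \<tau> s"
      "\<not> standard (subst_tm \<sigma> t) \<Longrightarrow> subst_tm \<sigma> t = subst_tm \<tau> t"
      using s t by (auto simp: standard_def)
    show ?thesis
    proof (cases "standard (subst_tm \<sigma> s) \<longleftrightarrow> standard (subst_tm \<sigma> t)")
      \<comment> \<open>Both terms are nonstandard here, so the two assignments give them the same
        values.\<close>
      case True
      with False same show ?thesis by simp
    next
      case False
      \<comment> \<open>Exactly one term is standard, so the equation fails under both
        assignments.\<close>
      with std show ?thesis using standard_cong by blast
    qed
  next
    case True
    with s t obtain a b e a' b' e' where ab: "(a, b) \<in> R" "e \<le> depth_tm s" "(a', b') \<in> R"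
        "e' \<le> depth_tm t"
      and eqs: "subst_tm \<sigma> s \<approx> numeral_tm (e + a)" "subst_tm \<tau> s \<approx> numeral_tm (e + b)"
        "subst_tm \<sigma> t \<approx> numeral_tm (e' + a')" "subst_tm \<tau> t \<approx> numeral_tm (e' + b')"
      by metis
    \<comment> \<open>Either equation makes its difference, \<open>a - a'\<close> or
      \<open>b - b'\<close>, equal to \<open>e' - e\<close>, which is within the distance that
      \<open>R\<close> preserves.\<close>
    have "e + a = e' + a' \<longleftrightarrow> e + b = e' + b'"
      using position_close[OF R ab(1,3)] ab(2,4) by linarith
    then show ?thesis
      using equal_cong[OF eqs(1,3)] equal_cong[OF eqs(2,4)] by (simp add: numeral_equal_iff)
  qed
qed

lemma related_forth:
  assumes R: "position (2 * d) R"
  shows "\<exists>R' t'. position d R' \<and> R \<subseteq> R' \<and> related R' t t'"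
proof (cases "standard t")
  case True
  then obtain c where c: "t \<approx> numeral_tm c" by (auto simp: standard_def)
  obtain c' where "position d (insert (c, c') R)" using position_forth[OF R] by blast
  moreover have "related (insert (c, c') R) t (numeral_tm c')"
    using c equal_refl by (auto simp: related_def)
  ultimately show ?thesis by blast
next
  case False
  have "position d R" using R by (rule position_mono) simp
  with False show ?thesis by (auto simp: related_def)
qed

text \<open>Induction on \<open>p\<close> plays the game: an equation is settled by
  \<open>equal_transfer\<close>, and each quantifier costs one move and halves the preserved
  distance.\<close>

lemma transfer:
  assumes "position (radius p) R" "\<And>i. related R (\<sigma> i) (\<tau> i)"
  shows "subst \<sigma> p \<in> \<Gamma> \<longleftrightarrow> subst \<tau> p \<in> \<Gamma>"
  using assms
proof (induction p arbitrary: R \<sigma> \<tau>)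
  case Fls
  show ?case by simp
next
  case (Eq s t)
  then show ?case using equal_transfer[of s t R \<sigma> \<tau>] by simp
next
  case (Imp p q)
  have "position (radius p) R" "position (radius q) R"
    using Imp.prems(1) by (auto elim: position_mono)
  then show ?case using Imp.IH[OF _ Imp.prems(2)] by (simp add: Imp_iff)
next
  case (All p)
  \<comment> \<open>Stated for arbitrary positions, so that swapping the sides and using
    \<open>R\<inverse>\<close> yields the other direction.\<close>
  have forth: "subst \<tau> (All p) \<in> \<Gamma> \<Longrightarrow> subst \<sigma> (All p) \<in> \<Gamma>"
    if R: "position (2 * radius p) R" and rel: "\<And>i. related R (\<sigma> i) (\<tau> i)" for R \<sigma> \<tau>
    unfolding All_iff
  proof
    fix t assume all: "\<forall>t. subst (case_nat t \<tau>) p \<in> \<Gamma>"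
    obtain R' t' where R': "position (radius p) R'" "R \<subseteq> R'" "related R' t t'"
      using related_forth[OF R] by blast
    have "related R' (case_nat t \<sigma> i) (case_nat t' \<tau> i)" for i
      using R'(3) related_mono[OF rel R'(2)] by (cases i) simp_all
    then have "subst (case_nat t \<sigma>) p \<in> \<Gamma> \<longleftrightarrow> subst (case_nat t' \<tau>) p \<in> \<Gamma>"
      by (rule All.IH[OF R'(1)])
    with all show "subst (case_nat t \<sigma>) p \<in> \<Gamma>" by blast
  qed
  have "position (2 * radius p) R" using All.prems(1) by simp
  then have "subst \<tau> (All p) \<in> \<Gamma> \<Longrightarrow> subst \<sigma> (All p) \<in> \<Gamma>"
    and "subst \<sigma> (All p) \<in> \<Gamma> \<Longrightarrow> subst \<tau> (All p) \<in> \<Gamma>"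
    using forth[of R \<sigma> \<tau>] forth[of "R\<inverse>" \<tau> \<sigma>] All.prems(2) position_converse related_converse
    by blast+
  then show ?case by blast
qed

lemma inst_numeral_transfer:
  assumes "fv p \<subseteq> {0}" "radius p < n" "radius p < m"
  shows "inst p (numeral_tm n) \<in> \<Gamma> \<longleftrightarrow> inst p (numeral_tm m) \<in> \<Gamma>"
proof -
  \<comment> \<open>The constant assignment agrees with \<open>inst\<close> on \<open>p\<close> and
    leaves a single pair of terms to relate.\<close>
  have inst: "inst p (numeral_tm k) = subst (\<lambda>_. numeral_tm k) p" for k
    unfolding inst_def using assms(1) by (intro subst_cong) auto
  \<comment> \<open>Both numbers are farther than \<open>radius p\<close> from zero, so the two
    pairs impose no condition on each other.\<close>
  have "position (radius p) {(0, 0), (n, m)}" using assms(2,3) by (auto simp: position_def)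
  moreover have "related {(0, 0), (n, m)} (numeral_tm n) (numeral_tm m)"
    using equal_refl by (auto simp: related_def)
  ultimately show ?thesis unfolding inst by (rule transfer)
qed

end

section \<open>Weakly representable sets\<close>

lemma succ_model_if_extends:
  assumes "henkin \<Gamma>" "extends S Succ_minus" "S \<subseteq> \<Gamma>"
  shows "succ_model \<Gamma>"
proof -
  interpret henkin \<Gamma> by fact
  \<comment> \<open>The form \<open>subst Var p\<close> lets \<open>All_iff\<close> evaluate the
    quantifiers of the axioms.\<close>
  have axiom: "subst Var p \<in> \<Gamma>" if "p \<in> Succ_minus" for p
  proof -
    have "sentence p"
      using that by (auto simp: Succ_minus_def sentence_def Neg_def Exists_def)
    then have "S \<turnstile> p" using assms(2) that proves.Hyp unfolding extends_def by blast
    then show ?thesis using closed proves_mono assms(3) subst_Var by metis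
  qed
  have inj: "subst Var (All (All (Imp (Eq (Succ (Var 1)) (Succ (Var 0))) (Eq (Var 1) (Var 0))))) \<in> \<Gamma>"
    and nz: "subst Var (All (Neg (Eq (Succ (Var 0)) Zero))) \<in> \<Gamma>"
    by (intro axiom; simp add: Succ_minus_def)+
  show ?thesis
  proof
    show "Eq s t \<in> \<Gamma>" if "Eq (Succ s) (Succ t) \<in> \<Gamma>" for s t
      using inj that by (simp add: All_iff Imp_iff del: subst.simps(4))
    show "Eq (Succ t) Zero \<notin> \<Gamma>" for t
      using nz by (simp add: All_iff Neg_def Imp_iff Fls_notin del: subst.simps(4))
  qed
qed

lemma proves_iff_succ_models:
  assumes "is_theory S" "extends S Succ_minus"
  shows "S \<turnstile> p \<longleftrightarrow> (\<forall>\<Gamma>. succ_model \<Gamma> \<longrightarrow> S \<subseteq> \<Gamma> \<longrightarrow> p \<in> \<Gamma>)"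
  using completeness[OF assms(1)] succ_model_if_extends[OF _ assms(2)] proves_mono
    henkin.closed succ_model.axioms(1) by metis

text \<open>Consistency supplies one model containing \<open>S\<close>; there the instances at
  numbers outside \<open>X\<close> fail, hence they are unprovable.\<close>

lemma weakly_representableI:
  assumes "is_theory S" "extends S Succ_minus" "consistent S" "fv p \<subseteq> {0}"
    and iff: "\<And>\<Gamma> n. succ_model \<Gamma> \<Longrightarrow> inst p (numeral_tm n) \<in> \<Gamma> \<longleftrightarrow> n \<in> X"
  shows "weakly_representable S X"
proof -
  obtain \<Gamma> where "succ_model \<Gamma>" "S \<subseteq> \<Gamma>"
    using assms(3) proves_iff_succ_models[OF assms(1,2)] unfolding consistent_def by blast
  then have "n \<in> X \<longleftrightarrow> S \<turnstile> inst p (numeral_tm n)" for n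
    using iff proves_iff_succ_models[OF assms(1,2)] by blast
  with assms(4) show ?thesis unfolding weakly_representable_def by blast
qed

section \<open>Formulas for finite and cofinite sets\<close>

primrec one_of :: "nat list \<Rightarrow> fm" where
  "one_of [] = Fls"
| "one_of (n # ns) = Imp (Neg (Eq (Var 0) (numeral_tm n))) (one_of ns)"

text \<open>Numerals are closed, so \<open>one_of ns\<close>, the disjunction of the equations
  between index 0 and the listed numerals, has at most that one free variable.\<close>

lemma fv_numeral_tm: "fv_tm (numeral_tm n) = {}"
  by (induction n) auto

lemma fv_one_of: "fv (one_of ns) \<subseteq> {0}"
  by (induction ns) (auto simp: Neg_def fv_numeral_tm)

lemma (in succ_model) inst_one_of_iff: "inst (one_of ns) (numeral_tm n) \<in> \<Gamma> \<longleftrightarrow> n \<in> set ns"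
  by (induction ns) (auto simp: inst_def Neg_def Imp_iff Fls_notin numeral_equal_iff)

lemma finite_or_cofinite_if_eventually_constant:
  fixes X :: "nat set"
  assumes "\<And>n m. N < n \<Longrightarrow> N < m \<Longrightarrow> n \<in> X \<longleftrightarrow> m \<in> X"
  shows "finite X \<or> finite (- X)"
proof -
  have "X \<subseteq> {..N} \<or> - X \<subseteq> {..N}" using assms by (auto simp: subset_iff) (meson not_le)
  then show ?thesis using finite_subset by blast
qed

theorem theorem4p4:
  fixes S :: "fm set" and X :: "nat set"
  assumes "is_theory S"
    and "extends S Succ_minus"
    and "consistent S"
  shows "weakly_representable S X \<longleftrightarrow> finite X \<or> finite (- X)"
proof
  assume "weakly_representable S X"
  then obtain p where p: "fv p \<subseteq> {0}" "\<And>n. n \<in> X \<longleftrightarrow> S \<turnstile> inst p (numeral_tm n)"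
    unfolding weakly_representable_def by blast
  \<comment> \<open>The bound \<open>radius p\<close> is the same for every model, so the transfers
    in all models combine to one about provability.\<close>
  have "n \<in> X \<longleftrightarrow> m \<in> X" if "radius p < n" "radius p < m" for n m
    using succ_model.inst_numeral_transfer[OF _ p(1) that]
    unfolding p(2) proves_iff_succ_models[OF assms(1,2)] by blast
  then show "finite X \<or> finite (- X)" by (rule finite_or_cofinite_if_eventually_constant)
next
  assume "finite X \<or> finite (- X)"
  then show "weakly_representable S X"
  proof
    assume "finite X"
    then obtain ns where "X = set ns" using finite_list by blast
    then show ?thesis
      by (intro weakly_representableI[OF assms fv_one_of[of ns]]) (simp add: succ_model.inst_one_of_iff)
  next
    assume "finite (- X)"
    then obtain ns where ns: "- X = set ns" using finite_list by metis
    have "inst (Neg (one_of ns)) (numeral_tm n) \<in> \<Gamma> \<longleftrightarrow> n \<in> X" if "succ_model \<Gamma>" for \<Gamma> n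
    proof -
      interpret succ_model \<Gamma> by fact
      \<comment> \<open>Negation is evaluated inside a Henkin set, where it amounts to
        non-membership.\<close>
      have "inst (Neg (one_of ns)) (numeral_tm n) \<in> \<Gamma> \<longleftrightarrow> inst (one_of ns) (numeral_tm n) \<notin> \<Gamma>"
        by (simp add: inst_def Neg_def Imp_iff Fls_notin)
      then show ?thesis using inst_one_of_iff ns by auto
    qed
    then show ?thesis
      using fv_one_of by (intro weakly_representableI[OF assms, of "Neg (one_of ns)"]) (auto simp: Neg_def)
  qed
qed

end
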